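(* Let $X$ be a Banach space over $\mathbb{K}$ ($\mathbb{K}=\mathbb{R}$ or $\mathbb{C}$), let $f\in \operatorname{Lip}(X,\mathbb{R})$, $\varepsilon>0$, and $A\subset S_X$. If $\overline{\operatorname{conv}}(A)\cap S(S_X,f,\varepsilon)\neq\emptyset$, then $A\cap S(S_X,f,\varepsilon)\neq\emptyset$.
   Context: $S_X$ is the unit sphere of $X$; $\overline{\operatorname{conv}}(A)$ is the closed convex hull of $A$. $\operatorname{Lip}(X,\mathbb{R})$ is the space of Lipschitz functions $f:X\to\mathbb{R}$ (not necessarily linear), with $\|f\|=\sup\left\{\frac{|f(x_1)-f(x_2)|}{\|x_1-x_2\|} : x_1\neq x_2\in X\right\}$. (Formally one identifies functions differing by a constant, or requires $f(0)=0$; only differences $f(x_1)-f(x_2)$ matter.) For $f\in\operatorname{Lip}(X,\mathbb{R})$ and $\varepsilon>0$, $$S(S_X,f,\varepsilon):=\left\{\frac{x_1-x_2}{\|x_1-x_2\|} : x_1,x_2\in X,\ x_1\neq x_2,\ \frac{f(x_1)-f(x_2)}{\|x_1-x_2\|}>\|f\|-\varepsilon\right\}.$$ *)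

theory Defs
  imports "HOL-Analysis.Analysis"
begin

text \<open>
  A complex Banach space enters as its underlying real one, an instance of the class
  \<open>banach\<close>: Lipschitz functions, their norm, slices and convex hulls involve real scalars only.
  Functions differing by a constant are not identified; every notion below depends
  only on the differences \<open>f x\<^sub>1 - f x\<^sub>2\<close>.
\<close>

definition Lip :: "('a::real_normed_vector \<Rightarrow> real) set" where
  "Lip = {f. \<exists>L. L-lipschitz_on UNIV f}"

text \<open>
  On the zero space the supremum is over the empty set and so unspecified; all
  slices are then empty whatever its value.
\<close>

definition lip_norm :: "('a::real_normed_vector \<Rightarrow> real) \<Rightarrow> real" where
  "lip_norm f = Sup {\<bar>f x\<^sub>1 - f x\<^sub>2\<bar> / norm (x\<^sub>1 - x\<^sub>2) | x\<^sub>1 x\<^sub>2. x\<^sub>1 \<noteq> x\<^sub>2}"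

definition lip_slice :: "('a::real_normed_vector \<Rightarrow> real) \<Rightarrow> real \<Rightarrow> 'a set" where
  "lip_slice f \<epsilon> = {(x\<^sub>1 - x\<^sub>2) /\<^sub>R norm (x\<^sub>1 - x\<^sub>2) | x\<^sub>1 x\<^sub>2.
     x\<^sub>1 \<noteq> x\<^sub>2 \<and> (f x\<^sub>1 - f x\<^sub>2) / norm (x\<^sub>1 - x\<^sub>2) > lip_norm f - \<epsilon>}"

end

theory Submission
  imports Defs
begin

text \<open>
  Being outside the slice is a bound on increments along a direction: a unit vector \<open>y\<close> is not in
  the slice iff \<open>f (x + t y) - f x \<le> (\<parallel>f\<parallel> - \<epsilon>) t\<close> for all \<open>x\<close> and \<open>t \<ge> 0\<close>. Without
  the restriction to unit vectors, the directions \<open>y\<close> with this property form a closed convex set: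
  walk along a convex combination one summand at a time. So if \<open>A\<close> misses the slice, its closed
  convex hull does too.
\<close>

definition increment_bounded :: "('a::real_normed_vector \<Rightarrow> real) \<Rightarrow> real \<Rightarrow> 'a set" where
  "increment_bounded f c = {y. \<forall>x. \<forall>t\<ge>0. f (x + t *\<^sub>R y) - f x \<le> c * t}"

lemma increment_boundedD:
  "y \<in> increment_bounded f c \<Longrightarrow> 0 \<le> t \<Longrightarrow> f (x + t *\<^sub>R y) - f x \<le> c * t"
  by (simp add: increment_bounded_def)

lemma convex_increment_bounded: "convex (increment_bounded f c)"
proof (rule convexI)
  fix y z and u v :: real
  assume y: "y \<in> increment_bounded f c" and z: "z \<in> increment_bounded f c"
    and uv: "0 \<le> u" "0 \<le> v" "u + v = 1"
  have "f (x + t *\<^sub>R (u *\<^sub>R y + v *\<^sub>R z)) - f x \<le> c * t" if "0 \<le> t" for x t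
  proof -
    have "f (x + (t * u) *\<^sub>R y) - f x \<le> c * (t * u)"
      using y uv that by (intro increment_boundedD) auto
    \<comment> \<open>The second leg starts where the first one ends. The bound applies there
      because \<open>increment_bounded\<close> quantifies over every base point.\<close>
    moreover have "f (x + (t * u) *\<^sub>R y + (t * v) *\<^sub>R z) - f (x + (t * u) *\<^sub>R y) \<le> c * (t * v)"
      using z uv that by (intro increment_boundedD) auto
    moreover have "c * (t * u) + c * (t * v) = c * t"
      using uv(3) by (metis distrib_left mult.right_neutral)
    ultimately show ?thesis
      by (simp add: scaleR_add_right add.assoc)
  qed
  then show "u *\<^sub>R y + v *\<^sub>R z \<in> increment_bounded f c"
    by (simp add: increment_bounded_def)
qed

text \<open>For fixed \<open>x\<close> and \<open>t\<close> the inequality is a closed condition on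
  \<open>y\<close>, as \<open>f\<close> is continuous; the set is an intersection of such
  conditions.\<close>

lemma closed_increment_bounded:
  assumes "continuous_on UNIV f"
  shows "closed (increment_bounded f c)"
proof -
  have "closed {y. f (x + t *\<^sub>R y) - f x \<le> c * t}" for x t
    by (intro closed_Collect_le continuous_intros continuous_on_compose2[OF assms]) auto
  then show ?thesis
    unfolding increment_bounded_def by (intro closed_Collect_all closed_Collect_imp) auto
qed

text \<open>For a unit vector \<open>y\<close>, the length of \<open>t *\<^sub>R y\<close> is
  \<open>t\<close>, so dividing the increment bound by \<open>t > 0\<close> gives the negated slice
  inequality for the pair \<open>x + t *\<^sub>R y\<close>, \<open>x\<close>.\<close>

lemma unit_in_increment_bounded_iff:
  assumes "norm y = 1"
  shows "y \<in> increment_bounded f (lip_norm f - \<epsilon>) \<longleftrightarrow> y \<notin> lip_slice f \<epsilon>"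
proof
  assume y: "y \<in> increment_bounded f (lip_norm f - \<epsilon>)"
  show "y \<notin> lip_slice f \<epsilon>"
  proof
    assume "y \<in> lip_slice f \<epsilon>"
    then obtain x1 x2 where x: "y = (x1 - x2) /\<^sub>R norm (x1 - x2)" "x1 \<noteq> x2"
      "(f x1 - f x2) / norm (x1 - x2) > lip_norm f - \<epsilon>"
      unfolding lip_slice_def by blast
    have "x2 + norm (x1 - x2) *\<^sub>R y = x1"
      using x(1,2) by simp
    then have "f x1 - f x2 \<le> (lip_norm f - \<epsilon>) * norm (x1 - x2)"
      using increment_boundedD[OF y, of "norm (x1 - x2)" x2] by simp
    with x(2,3) show False
      by (simp add: pos_less_divide_eq)
  qed
next
  assume y: "y \<notin> lip_slice f \<epsilon>"
  have "f (x + t *\<^sub>R y) - f x \<le> (lip_norm f - \<epsilon>) * t" if "0 \<le> t" for x t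
  \<comment> \<open>At \<open>t = 0\<close> the two points coincide and define no slope, but both
    sides of the bound vanish.\<close>
  proof (cases "t = 0")
    case False
    then have t: "0 < t" using that by simp
    show ?thesis
    proof (rule ccontr)
      assume "\<not> ?thesis"
      then have "(f (x + t *\<^sub>R y) - f x) / norm (x + t *\<^sub>R y - x) > lip_norm f - \<epsilon>"
        using t assms by (simp add: pos_less_divide_eq)
      moreover have "y = (x + t *\<^sub>R y - x) /\<^sub>R norm (x + t *\<^sub>R y - x)" "x + t *\<^sub>R y \<noteq> x"
        using t assms by auto
      ultimately have "y \<in> lip_slice f \<epsilon>"
        unfolding lip_slice_def by blast
      with y show False ..
    qed
  qed simp
  then show "y \<in> increment_bounded f (lip_norm f - \<epsilon>)"
    by (simp add: increment_bounded_def)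
qed

theorem lemma2p4:
  fixes f :: "'a::banach \<Rightarrow> real" and \<epsilon> :: real and A :: "'a set"
  assumes "f \<in> Lip"
    and "\<epsilon> > 0"
    and "A \<subseteq> sphere 0 1"
    and "closure (convex hull A) \<inter> lip_slice f \<epsilon> \<noteq> {}"
  shows "A \<inter> lip_slice f \<epsilon> \<noteq> {}"
proof
  assume disj: "A \<inter> lip_slice f \<epsilon> = {}"
  have cont: "continuous_on UNIV f"
    using assms(1) lipschitz_on_continuous_on unfolding Lip_def by blast
  have "A \<subseteq> increment_bounded f (lip_norm f - \<epsilon>)"
  proof
    fix a assume "a \<in> A"
    then have "norm a = 1" "a \<notin> lip_slice f \<epsilon>"
      using assms(3) disj by auto
    then show "a \<in> increment_bounded f (lip_norm f - \<epsilon>)"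
      by (simp add: unit_in_increment_bounded_iff)
  qed
  then have sub: "closure (convex hull A) \<subseteq> increment_bounded f (lip_norm f - \<epsilon>)"
    by (intro closure_minimal hull_minimal convex_increment_bounded closed_increment_bounded cont)
  obtain y where y: "y \<in> closure (convex hull A)" "y \<in> lip_slice f \<epsilon>"
    using assms(4) by blast
  \<comment> \<open>Points of the closed convex hull may have norm below 1; it is membership in the
    slice that makes \<open>y\<close> a unit vector.\<close>
  from y(2) have "norm y = 1"
    unfolding lip_slice_def by auto
  with y sub show False
    using unit_in_increment_bounded_iff by blast
qed

end
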